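(* Let $\varphi\in L^\infty(\mathbb D)$, let $\rho_0=\frac1{32}\min(1,\|\varphi\|_\infty^{-1})$, and let $\rho\in(0,\rho_0)$. Suppose that (i) $\operatorname{Re}\varphi(z)\ge|\operatorname{Im}\varphi(z)|^2$ for all $z\in\mathbb D$ with $|\varphi(z)|\ge\rho$; (ii) $|\varphi(z)|>\rho$ for all $z\in\mathbb D$ with $|z|\ge\rho$; and (iii) the set $\Lambda=\{z\in\mathbb D:|\varphi(z)|\le\rho\}$ has area $|\Lambda|\le\rho^6$ (area measured with the normalized measure $dA$). Then the Toeplitz operator $T_\varphi$ is invertible on $A^2$.
   Context: $\mathbb D$ is the open unit disc, $dA=\frac1\pi r\,dr\,d\theta$ normalized area measure, $A^2$ the Bergman space of analytic functions in $L^2(\mathbb D,dA)$, $P$ the orthogonal projection $L^2\to A^2$, and for $\varphi\in L^\infty(\mathbb D)$ the Toeplitz operator is $T_\varphi f=P(\varphi f)$ on $A^2$. $\|\cdot\|_\infty$ is the (essential) supremum norm. *)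

theory Defs
  imports "HOL-Analysis.Analysis"
begin

definition dA :: "complex measure" where
  "dA = scale_measure (ennreal (1 / pi)) (restrict_space lebesgue (ball 0 1))"

text \<open>Bergman space A^2: analytic functions on the disc, square integrable w.r.t. dA.
  Elements are represented canonically by being 0 outside the disc.\<close>
definition bergman :: "(complex \<Rightarrow> complex) set" where
  "bergman = {f. f holomorphic_on ball 0 1 \<and> (\<forall>z. z \<notin> ball 0 1 \<longrightarrow> f z = 0)
                 \<and> integrable dA (\<lambda>z. (cmod (f z))\<^sup>2)}"

definition L2_inner :: "(complex \<Rightarrow> complex) \<Rightarrow> (complex \<Rightarrow> complex) \<Rightarrow> complex" where
  "L2_inner f g = (LINT z|dA. f z * cnj (g z))"

definition L2_norm :: "(complex \<Rightarrow> complex) \<Rightarrow> real" where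
  "L2_norm f = sqrt (LINT z|dA. (cmod (f z))\<^sup>2)"

definition Linf_norm :: "(complex \<Rightarrow> complex) \<Rightarrow> real" where
  "Linf_norm \<phi> = Inf {C. C \<ge> 0 \<and> (AE z in dA. cmod (\<phi> z) \<le> C)}"

definition essentially_bounded :: "(complex \<Rightarrow> complex) \<Rightarrow> bool" where
  "essentially_bounded \<phi> \<longleftrightarrow> \<phi> \<in> borel_measurable dA \<and> (\<exists>C. AE z in dA. cmod (\<phi> z) \<le> C)"

text \<open>Toeplitz operator T_phi f = P(phi f): the unique element g of A^2 such that
  phi f - g is orthogonal to A^2.\<close>
definition toeplitz :: "(complex \<Rightarrow> complex) \<Rightarrow> (complex \<Rightarrow> complex) \<Rightarrow> (complex \<Rightarrow> complex)" where
  "toeplitz \<phi> f = (THE g. g \<in> bergman \<and>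
       (\<forall>h\<in>bergman. L2_inner (\<lambda>z. \<phi> z * f z - g z) h = 0))"

definition invertible_on_bergman :: "((complex \<Rightarrow> complex) \<Rightarrow> (complex \<Rightarrow> complex)) \<Rightarrow> bool" where
  "invertible_on_bergman T \<longleftrightarrow> bij_betw T bergman bergman \<and>
     (\<exists>C. \<forall>f\<in>bergman. L2_norm f \<le> C * L2_norm (T f))"

end

theory Submission
  imports Defs "HOL-Complex_Analysis.Complex_Analysis"
begin

text \<open>
  The quadratic form of the Toeplitz operator is coercive, so the theorem follows from Lax--Milgram.
  Off \<open>\<Lambda>\<close>, condition (i) and \<open>\<bar>\<phi>\<bar> > \<rho>\<close> force \<open>Re \<phi> \<ge> \<rho>\<^sup>2/2\<close>. On \<open>\<Lambda>\<close>, which by (ii) lies in the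
  disc of radius \<open>\<rho> < 1/32\<close>, the area mean value property of \<open>f\<^sup>2\<close> gives \<open>\<bar>f\<bar>\<^sup>2 \<le> 4 \<parallel>f\<parallel>\<^sup>2\<close>, so \<open>\<Lambda>\<close>
  contributes at least \<open>- 8 \<rho> \<bar>\<Lambda>\<bar> \<parallel>f\<parallel>\<^sup>2 \<ge> - 8 \<rho>\<^sup>7 \<parallel>f\<parallel>\<^sup>2\<close>. Altogether
  \<open>Re \<langle>T\<^sub>\<phi> f, f\<rangle> \<ge> (\<rho>\<^sup>2/4) \<parallel>f\<parallel>\<^sup>2\<close>. The Bergman space is turned into a type of class
  \<open>real_inner\<close> and \<open>complete_space\<close> using the real part of the inner product.
\<close>

section \<open>Riesz representation and Lax--Milgram\<close>

text \<open>Direct method: the representing vector is the minimiser of \<open>q\<close>, the square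
  of the norm minus twice \<open>l\<close>. The parallelogram law makes a minimising sequence
  Cauchy, completeness provides its limit, and the first variation at the minimiser must
  vanish.\<close>

lemma riesz_representation:
  fixes l :: "'a::{real_inner,complete_space} \<Rightarrow> real"
  assumes "bounded_linear l"
  shows "\<exists>g. \<forall>h. l h = g \<bullet> h"
proof -
  interpret l: bounded_linear l by fact
  obtain K where K: "\<And>x. norm (l x) \<le> norm x * K" "K > 0"
    using l.pos_bounded by blast
  define q where "q x = (norm x)\<^sup>2 - 2 * l x" for x
  have q_lower: "- K\<^sup>2 \<le> q x" for x
  proof -
    have "0 \<le> (norm x - K)\<^sup>2" by simp
    moreover have "l x \<le> norm x * K" using K(1)[of x] by simp
    ultimately show ?thesis by (simp add: q_def power2_diff)
  qed
  define m where "m = Inf (range q)"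
  have bdd: "bdd_below (range q)" using q_lower by (intro bdd_belowI[of _ "- K\<^sup>2"]) auto
  have m_le: "m \<le> q x" for x
    unfolding m_def by (rule cInf_lower[OF _ bdd]) simp
  have "\<exists>x. q x < m + 1 / real (Suc n)" for n
    using cInf_lessD[of "range q" "m + 1 / real (Suc n)"] by (auto simp: m_def)
  then obtain x where x: "\<And>n. q (x n) < m + 1 / real (Suc n)" by metis
  \<comment> \<open>The value of \<open>q\<close> at the midpoint of \<open>a\<close> and
    \<open>b\<close> is at least \<open>m\<close>, so almost minimal points lie close
    together.\<close>
  have par: "(norm (a - b))\<^sup>2 \<le> 2 * (q a - m) + 2 * (q b - m)" for a b
  proof -
    have "q a + q b - 2 * q ((1/2) *\<^sub>R (a + b)) = (norm (a - b))\<^sup>2 / 2"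
      unfolding q_def power2_norm_eq_inner
      by (simp add: l.scaleR l.add algebra_simps inner_commute)
    with m_le[of "(1/2) *\<^sub>R (a + b)"] show ?thesis by (simp add: algebra_simps)
  qed
  have "Cauchy x"
  proof (rule CauchyI)
    fix e :: real assume e: "0 < e"
    obtain N where N: "1 / real (Suc N) < e\<^sup>2 / 4"
      using reals_Archimedean[of "e\<^sup>2 / 4"] e by (auto simp: inverse_eq_divide)
    have "norm (x i - x j) < e" if "i \<ge> N" "j \<ge> N" for i j
    proof -
      have "1 / real (Suc i) \<le> 1 / real (Suc N)" "1 / real (Suc j) \<le> 1 / real (Suc N)"
        using that by (auto simp: frac_le)
      then have "q (x i) < m + e\<^sup>2 / 4" "q (x j) < m + e\<^sup>2 / 4"
        using x[of i] x[of j] N by (meson add_left_mono less_le_trans less_trans not_le)+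
      then have "(norm (x i - x j))\<^sup>2 < e\<^sup>2"
        using par[of "x i" "x j"] by (simp add: field_simps)
      then show ?thesis using e by (simp add: power2_less_imp_less)
    qed
    then show "\<exists>M. \<forall>m\<ge>M. \<forall>n\<ge>M. norm (x m - x n) < e" by blast
  qed
  then obtain g where g: "x \<longlonglongrightarrow> g"
    using Cauchy_convergent convergent_def by blast
  have "(\<lambda>n. q (x n)) \<longlonglongrightarrow> q g"
    unfolding q_def by (intro tendsto_intros g l.tendsto)
  moreover have "(\<lambda>n. m + 1 / real (Suc n)) \<longlonglongrightarrow> m + 0"
    by (intro tendsto_intros LIMSEQ_Suc lim_1_over_n)
  ultimately have "q g \<le> m"
    using x by (metis (no_types, lifting) LIMSEQ_le add.right_neutral less_imp_le)
  have "l h = g \<bullet> h" for h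
  proof (rule ccontr)
    define d where "d = g \<bullet> h - l h"
    assume "l h \<noteq> g \<bullet> h"
    then have d: "d \<noteq> 0" by (simp add: d_def)
    then have h: "h \<bullet> h > 0" by (auto simp: d_def l.zero)
    \<comment> \<open>Along the line through \<open>g\<close> in direction \<open>h\<close> the
      increment of \<open>q\<close> is the quadratic
      \<open>2 * t * d + t\<^sup>2 * (h \<bullet> h)\<close>. This \<open>t\<close> minimises it and
      makes it negative, contradicting minimality of \<open>g\<close>.\<close>
    define t where "t = - d / (h \<bullet> h)"
    have "q (g + t *\<^sub>R h) = q g + (2 * t * d + t\<^sup>2 * (h \<bullet> h))"
      unfolding q_def power2_norm_eq_inner
      by (simp add: l.scaleR l.add algebra_simps inner_commute power2_eq_square d_def)
    also have "2 * t * d + t\<^sup>2 * (h \<bullet> h) = - (d\<^sup>2 / (h \<bullet> h))"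
      using h by (simp add: t_def power2_eq_square field_simps)
    also have "\<dots> < 0" using d h by simp
    finally show False using m_le[of "g + t *\<^sub>R h"] \<open>q g \<le> m\<close> by linarith
  qed
  then show ?thesis by blast
qed

text \<open>Riesz applied to each \<open>B x\<close> produces \<open>T\<close>. Coercivity bounds
  \<open>T\<close> from below, hence injectivity; surjectivity comes from Banach's fixed point
  theorem, so \<open>B\<close> may be nonsymmetric.\<close>

lemma lax_milgram:
  fixes B :: "'a::{real_inner,complete_space} \<Rightarrow> 'a \<Rightarrow> real"
  assumes B: "bounded_bilinear B" and c: "c > 0"
    and coercive: "\<And>x. c * (norm x)\<^sup>2 \<le> B x x"
  obtains T where "\<And>x y. B x y = T x \<bullet> y" "bij T" "\<And>x. c * norm x \<le> norm (T x)"
proof -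
  interpret B: bounded_bilinear B by fact
  have "\<exists>g. \<forall>y. B x y = g \<bullet> y" for x
    by (rule riesz_representation) (rule B.bounded_linear_right)
  then obtain T where T: "\<And>x y. B x y = T x \<bullet> y" by metis
  have T_diff: "T (x - y) = T x - T y" for x y
    by (rule vector_eq_rdot[THEN iffD1]) (simp add: T[symmetric] B.diff_left inner_diff_left)
  obtain K0 where K0: "\<And>x y. norm (B x y) \<le> norm x * norm y * K0" "K0 > 0"
    using B.pos_bounded by blast
  \<comment> \<open>Enlarging the bound to at least \<open>c\<close> keeps
    \<open>1 - c\<^sup>2 / K\<^sup>2\<close> nonnegative, so that its square root can serve as a
    contraction factor.\<close>
  define K where "K = max K0 c"
  have K: "K > 0" "c \<le> K" using c by (auto simp: K_def)
  have T_upper: "norm (T x) \<le> K * norm x" for x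
  proof (cases "T x = 0")
    case False
    have "norm (T x) * norm (T x) \<le> norm x * norm (T x) * K0"
      using K0(1)[of x "T x"] by (simp add: T norm_eq_sqrt_inner)
    then have "norm (T x) \<le> norm x * K0" using False by simp
    also have "\<dots> \<le> norm x * K" by (simp add: K_def mult_left_mono)
    finally show ?thesis by (simp add: mult.commute)
  qed (use K in simp)
  have T_lower: "c * norm x \<le> norm (T x)" for x
  proof (cases "x = 0")
    case False
    have "c * norm x * norm x \<le> norm (T x) * norm x"
      using coercive[of x] norm_cauchy_schwarz[of "T x" x] by (simp add: T power2_eq_square)
    then show ?thesis using False by simp
  qed simp
  have "inj T"
  proof (rule injI)
    fix x y assume "T x = T y"
    then have "c * norm (x - y) \<le> 0" using T_lower[of "x - y"] by (simp add: T_diff)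
    then show "x = y" using c by (simp add: mult_le_0_iff)
  qed
  moreover have "surj T"
  proof (unfold surj_def, intro allI)
    fix g
    \<comment> \<open>The step size minimising the bound \<open>1 - 2 t c + t\<^sup>2 K\<^sup>2\<close> on the squared norm of \<open>x \<mapsto> x - t T x\<close>.\<close>
    define t where "t = c / K\<^sup>2"
    define s where "s = sqrt (1 - c\<^sup>2 / K\<^sup>2)"
    have cK: "0 < c\<^sup>2 / K\<^sup>2" "c\<^sup>2 / K\<^sup>2 \<le> 1" using c K by (auto simp: power_mono)
    have t: "t > 0" using c K by (simp add: t_def)
    have contr: "norm (x - t *\<^sub>R T x) \<le> s * norm x" for x
    proof (rule power2_le_imp_le)
      have "(norm (x - t *\<^sub>R T x))\<^sup>2 = (norm x)\<^sup>2 - 2 * t * B x x + t\<^sup>2 * (norm (T x))\<^sup>2"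
        unfolding T power2_norm_eq_inner
        by (simp add: algebra_simps inner_commute power2_eq_square)
      also have "\<dots> \<le> (norm x)\<^sup>2 - 2 * t * (c * (norm x)\<^sup>2) + t\<^sup>2 * (K * norm x)\<^sup>2"
        using t T_upper[of x] coercive[of x] by (intro add_mono diff_mono mult_left_mono power_mono) auto
      also have "\<dots> = (1 - c\<^sup>2 / K\<^sup>2) * (norm x)\<^sup>2"
        using K by (simp add: t_def field_simps power2_eq_square)
      finally show "(norm (x - t *\<^sub>R T x))\<^sup>2 \<le> (s * norm x)\<^sup>2"
        using cK by (simp add: s_def power_mult_distrib)
    qed (use cK in \<open>simp add: s_def\<close>)
    \<comment> \<open>Since \<open>t\<close> is nonzero, a fixed point of this map is exactly a
      solution of \<open>T x = g\<close>.\<close>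
    have "\<exists>!x. x - t *\<^sub>R (T x - g) = x"
    proof (rule banach_fix_type)
      show "s < 1" "0 \<le> s" using cK by (auto simp: s_def)
      show "\<forall>x y. dist (x - t *\<^sub>R (T x - g)) (y - t *\<^sub>R (T y - g)) \<le> s * dist x y"
        using contr[of "x - y" for x y] by (simp add: dist_norm T_diff algebra_simps)
    qed
    then show "\<exists>x. g = T x" using t by auto
  qed
  ultimately show ?thesis using that T T_lower by (metis bij_def)
qed

section \<open>Area mean value property\<close>

text \<open>Carries the invariance of Lebesgue measure under orthogonal maps of
  \<open>real^2\<close> over to the complex plane. Agreement on boxes suffices.\<close>

lemma lborel_complex_eq_distr:
  "(lborel :: complex measure) = distr lborel borel (\<lambda>v::real^2. Complex (v $ 1) (v $ 2))"
proof (rule lborel_eqI)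
  fix l u :: complex
  assume le: "\<And>b. b \<in> Basis \<Longrightarrow> l \<bullet> b \<le> u \<bullet> b"
  let ?J = "\<lambda>v::real^2. Complex (v $ 1) (v $ 2)"
  let ?l = "vector [Re l, Im l] :: real^2" and ?u = "vector [Re u, Im u] :: real^2"
  have J: "?J \<in> borel_measurable borel"
    by (intro borel_measurable_continuous_onI) (auto simp: complex_eq_iff intro!: continuous_intros simp: Complex_eq)
  have vimage: "?J -` box l u = box ?l ?u"
    by (auto simp: box_def Basis_complex_def mem_box_cart forall_2 inner_axis Basis_vec_def UNIV_2)
  have Basis2: "(Basis :: (real^2) set) = {axis 1 1, axis 2 1}"
    by (auto simp: Basis_vec_def UNIV_2)
  have "emeasure (distr lborel borel ?J) (box l u) = emeasure lborel (box ?l ?u)"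
    using J by (simp add: emeasure_distr vimage)
  also have "\<dots> = ennreal (\<Prod>b\<in>Basis. (u - l) \<bullet> b)"
    using le[of 1] le[of \<i>] by (simp add: emeasure_lborel_box_eq Basis2 Basis_complex_def axis_eq_axis inner_axis)
  finally show "emeasure (distr lborel borel ?J) (box l u) = ennreal (\<Prod>b\<in>Basis. (u - l) \<bullet> b)" .
qed simp

lemma lborel_complex_rotation:
  fixes c :: complex
  assumes c: "cmod c = 1"
  shows "distr lborel borel (\<lambda>w. c * w) = (lborel :: complex measure)"
proof (rule lborel_eqI[symmetric])
  fix l u :: complex
  assume le: "\<And>b. b \<in> Basis \<Longrightarrow> l \<bullet> b \<le> u \<bullet> b"
  let ?J = "\<lambda>v::real^2. Complex (v $ 1) (v $ 2)"
  \<comment> \<open>\<open>R\<close> is multiplication by \<open>cnj c\<close>, the inverse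
    rotation, in real coordinates. The preimage of a box under multiplication by \<open>c\<close>
    thus becomes the image of \<open>S\<close> under an orthogonal map.\<close>
  define R :: "real^2 \<Rightarrow> real^2"
    where "R v = vector [Re (cnj c * ?J v), Im (cnj c * ?J v)]" for v
  have J[measurable]: "?J \<in> borel_measurable borel"
    by (intro borel_measurable_continuous_onI) (auto intro!: continuous_intros simp: Complex_eq)
  have [measurable]: "(\<lambda>w. c * w) \<in> borel_measurable borel" by simp
  have JR: "?J (R v) = cnj c * ?J v" for v by (simp add: R_def complex_eq_iff)
  have cc: "c * cnj c = 1" using c by (simp add: complex_norm_square[symmetric])
  have R: "orthogonal_transformation R"
    unfolding orthogonal_transformation
  proof (intro conjI allI)
    show "linear R"
      by (rule linearI) (auto simp: R_def vec_eq_iff forall_2 algebra_simps)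
    fix v
    have "norm (R v) = cmod (?J (R v))"
      by (simp add: norm_vec_def L2_set_def UNIV_2 cmod_def)
    also have "\<dots> = cmod (?J v)" by (simp add: JR norm_mult c del: complex_cnj_mult)
    also have "\<dots> = norm v"
      by (simp add: norm_vec_def L2_set_def UNIV_2 cmod_def)
    finally show "norm (R v) = norm v" .
  qed
  define S where "S = ?J -` box l u"
  have S_borel: "S \<in> sets borel"
    unfolding S_def using J by (rule measurable_sets_borel) simp
  have emS: "emeasure lborel S = emeasure lborel (box l u)"
    using arg_cong[OF lborel_complex_eq_distr, of "\<lambda>M. emeasure M (box l u)"]
    by (simp add: emeasure_distr S_def)
  then have fin: "emeasure lborel S < \<infinity>" by (simp add: emeasure_lborel_box_eq)
  then have S: "S \<in> lmeasurable"
    using S_borel by (intro fmeasurableI) auto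
  have vimage: "?J -` ((\<lambda>w. c * w) -` box l u) = R ` S"
  proof (intro equalityI subsetI)
    fix v assume v: "v \<in> ?J -` ((\<lambda>w. c * w) -` box l u)"
    define v' :: "real^2" where "v' = vector [Re (c * ?J v), Im (c * ?J v)]"
    have J': "?J v' = c * ?J v" by (simp add: v'_def complex_eq_iff)
    have "?J (R v') = cnj c * c * ?J v" by (simp only: JR J' mult.assoc)
    then have "?J (R v') = ?J v" using cc by (simp add: mult.commute)
    then have "R v' = v" by (simp add: vec_eq_iff forall_2)
    moreover have "v' \<in> S" using v by (simp add: S_def J')
    ultimately show "v \<in> R ` S" by blast
  next
    fix v assume "v \<in> R ` S"
    then obtain v' where v': "v = R v'" "?J v' \<in> box l u" by (auto simp: S_def)
    have "c * ?J v = c * cnj c * ?J v'" by (simp only: v' JR mult.assoc)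
    then show "v \<in> ?J -` ((\<lambda>w. c * w) -` box l u)" using cc v' by simp
  qed
  have RS_borel: "R ` S \<in> sets borel"
    unfolding vimage[symmetric]
    by (rule measurable_sets_borel[OF J], rule measurable_sets_borel[where M=borel]) auto
  have RS: "R ` S \<in> lmeasurable" using R S by (rule measurable_orthogonal_image)
  have "emeasure (distr lborel borel (\<lambda>w. c * w)) (box l u)
      = emeasure lborel ((\<lambda>w. c * w) -` box l u)"
    by (simp add: emeasure_distr)
  also have "\<dots> = emeasure lborel (?J -` ((\<lambda>w. c * w) -` box l u))"
    using measurable_sets_borel[of "\<lambda>w. c * w" borel "box l u"]
    by (subst lborel_complex_eq_distr, subst emeasure_distr) auto
  also have "\<dots> = emeasure lebesgue (R ` S)"
    using RS_borel by (simp add: vimage)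
  also have "\<dots> = emeasure lebesgue S"
    using RS S measure_orthogonal_image[OF R S] by (simp add: emeasure_eq_measure2 fmeasurableD2)
  also have "\<dots> = emeasure lborel (box l u)"
    using S_borel by (simp add: emS)
  finally show "emeasure (distr lborel borel (\<lambda>w. c * w)) (box l u) = ennreal (\<Prod>b\<in>Basis. (u - l) \<bullet> b)"
    using le by (simp add: emeasure_lborel_box)
qed simp

text \<open>Rotating by the angle pi/n preserves the disc and the measure but multiplies
  \<open>w ^ n\<close> by -1, so the integral equals its own negative.\<close>

lemma integral_cball_power_eq_0:
  assumes "n > 0"
  shows "(LINT w|lborel. indicator (cball 0 r) w *\<^sub>R (w ^ n :: complex)) = 0" (is "?I = 0")
proof -
  define c where "c = cis (pi / n)"
  have c: "cmod c = 1" by (simp add: c_def)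
  have cn: "c ^ n = -1" unfolding c_def using assms by (subst Complex.DeMoivre) simp
  have "?I = (LINT w|distr lborel borel (\<lambda>w. c * w). indicator (cball 0 r) w *\<^sub>R (w ^ n))"
    by (simp add: lborel_complex_rotation c)
  also have "\<dots> = (LINT w|lborel. indicator (cball 0 r) (c * w) *\<^sub>R ((c * w) ^ n))"
    by (rule integral_distr) (auto intro!: borel_measurable_continuous_on_indicator continuous_intros)
  also have "\<dots> = (LINT w|lborel. - (indicator (cball 0 r) w *\<^sub>R (w ^ n)))"
    by (rule Bochner_Integration.integral_cong)
      (auto simp: power_mult_distrib cn c norm_mult indicator_def)
  also have "\<dots> = - ?I" by simp
  finally show ?thesis by simp
qed

text \<open>Integrate the power series about \<open>z\<close> term by term over the disc: every term
  of positive degree vanishes by rotation, and the constant term contributes \<open>f z\<close>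
  times the area.\<close>

lemma holomorphic_area_mean_value:
  assumes f: "f holomorphic_on ball z R" and r: "0 < r" "r < R"
  shows "(LINT w|lborel. indicator (cball z r) w *\<^sub>R f w) = of_real (pi * r\<^sup>2) * f z"
proof -
  define a where "a n = (deriv ^^ n) f z / fact n" for n
  have sums: "(\<lambda>n. a n * w ^ n) sums f (z + w)" if "cmod w < R" for w
    using holomorphic_power_series[OF f, of "z + w"] that by (simp add: a_def dist_norm)
  \<comment> \<open>Convergence at the intermediate radius \<open>(r + R) / 2\<close> yields
    absolute convergence at \<open>r\<close>, which justifies exchanging sum and integral.\<close>
  have "summable (\<lambda>n. norm (a n * of_real r ^ n))"
  proof (rule powser_insidea)
    show "summable (\<lambda>n. a n * of_real ((r + R) / 2) ^ n)"
      using r by (intro sums_summable[OF sums]) (simp del: of_real_add of_real_divide)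
    show "norm (of_real r :: complex) < norm (of_real ((r + R) / 2) :: complex)"
      using r by (simp del: of_real_add of_real_divide)
  qed
  then have summ: "summable (\<lambda>n. norm (a n) * r ^ n)"
    using r by (simp add: norm_mult norm_power)
  define g where "g n w = indicator (cball 0 r) w *\<^sub>R (a n * w ^ n)" for n and w :: complex
  have int: "integrable lborel (g n)" for n
    unfolding g_def
    by (intro borel_integrable_compact compact_cball continuous_intros)
  have bound: "norm (g n w) \<le> norm (a n) * r ^ n" for n w
    using r by (auto simp: g_def indicator_def norm_mult norm_power intro!: mult_left_mono power_mono)
  have bound_int: "(LINT w|lborel. norm (g n w)) \<le> norm (a n) * r ^ n * measure lborel (cball (0::complex) r)" for n
  proof -
    have "(LINT w|lborel. norm (g n w)) \<le> (LINT w|lborel. indicator (cball (0::complex) r) w *\<^sub>R (norm (a n) * r ^ n))"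
    proof (rule integral_mono)
      show "integrable lborel (\<lambda>w. indicator (cball (0::complex) r) w *\<^sub>R (norm (a n) * r ^ n))"
        by (intro borel_integrable_compact compact_cball continuous_intros)
      show "norm (g n w) \<le> indicator (cball (0::complex) r) w *\<^sub>R (norm (a n) * r ^ n)" for w
        using bound[of n w] by (auto simp: indicator_def g_def)
    qed (intro integrable_norm int)
    then show ?thesis by (simp add: mult.commute)
  qed
  have sum_g: "suminf (\<lambda>n. g n w) = indicator (cball 0 r) w *\<^sub>R f (z + w)" for w
    using sums_unique[OF sums, of w] r by (cases "w \<in> cball 0 r") (simp_all add: g_def)
  have "(LINT w|lborel. indicator (cball z r) w *\<^sub>R f w)
      = (LINT w|distr lborel borel ((+) z). indicator (cball z r) w *\<^sub>R f w)"
    by (simp add: lborel_distr_plus)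
  also have "\<dots> = (LINT w|lborel. indicator (cball z r) (z + w) *\<^sub>R f (z + w))"
  proof (rule integral_distr)
    have "cball z r \<subseteq> ball z R" using r by auto
    then have "continuous_on (cball z r) f"
      using f holomorphic_on_imp_continuous_on continuous_on_subset by blast
    then show "(\<lambda>w. indicator (cball z r) w *\<^sub>R f w) \<in> borel_measurable borel"
      by (intro borel_measurable_continuous_on_indicator) auto
  qed simp
  also have "\<dots> = (LINT w|lborel. suminf (\<lambda>n. g n w))"
    by (rule Bochner_Integration.integral_cong) (auto simp: sum_g indicator_def dist_norm)
  also have "\<dots> = (\<Sum>n. LINT w|lborel. g n w)"
  proof (rule integral_suminf[OF int])
    show "AE w in lborel. summable (\<lambda>n. norm (g n w))"
      using bound by (intro AE_I2 summable_comparison_test'[OF summ]) auto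
    show "summable (\<lambda>n. LINT w|lborel. norm (g n w))"
      using bound_int by (intro summable_comparison_test'[OF summable_mult2[OF summ]]) auto
  qed
  also have "\<dots> = (\<Sum>n. if n = 0 then LINT w|lborel. g 0 w else 0)"
  proof (rule suminf_cong)
    fix n
    have "(LINT w|lborel. g n w) = a n * (LINT w|lborel. indicator (cball 0 r) w *\<^sub>R w ^ n)"
      by (simp add: g_def flip: integral_mult_right_zero)
    then show "(LINT w|lborel. g n w) = (if n = 0 then LINT w|lborel. g 0 w else 0)"
      by (cases "n = 0") (simp_all add: integral_cball_power_eq_0)
  qed
  also have "\<dots> = (LINT w|lborel. g 0 w)"
    using sums_unique[OF sums_single[of 0 "\<lambda>_. LINT w|lborel. g 0 w"]] by simp
  also have "\<dots> = measure lborel (cball (0::complex) r) *\<^sub>R f z"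
    using emeasure_lborel_cball_finite[of "0::complex" r]
    by (simp add: g_def a_def integral_scaleR_left integrable_indicator_iff)
  also have "measure lborel (cball (0::complex) r) = pi * r\<^sup>2"
    using r content_cball[of r "0::complex"] by (simp add: unit_ball_vol_2)
  finally show ?thesis by (simp add: scaleR_conv_of_real)
qed

section \<open>The Bergman space as a Hilbert space\<close>

lemma space_dA [simp]: "space dA = ball 0 1"
  by (simp add: dA_def space_scale_measure)

lemma sets_dA: "sets dA = sets (lebesgue_on (ball 0 1))"
  by (simp add: dA_def)

lemma dA_eq_density: "dA = density (lebesgue_on (ball 0 1)) (\<lambda>_. ennreal (1 / pi))"
  by (rule measure_eqI) (auto simp: dA_def emeasure_density_const)

lemma finite_measure_dA: "finite_measure dA"
proof
  show "emeasure dA (space dA) \<noteq> \<infinity>"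
    using emeasure_lborel_ball_finite[of "0::complex" 1]
    by (simp add: dA_def space_scale_measure emeasure_restrict_space ennreal_mult_eq_top_iff)
qed

interpretation dA: finite_measure dA
  by (rule finite_measure_dA)

lemma continuous_on_imp_measurable_dA:
  fixes f :: "complex \<Rightarrow> 'a::euclidean_space"
  assumes "continuous_on (ball 0 1) f"
  shows "f \<in> borel_measurable dA"
  using continuous_imp_measurable_on_sets_lebesgue[OF assms]
  by (simp add: measurable_cong_sets[OF sets_dA refl])

lemma bergman_measurable: "f \<in> bergman \<Longrightarrow> f \<in> borel_measurable dA"
  by (auto simp: bergman_def holomorphic_on_imp_continuous_on intro!: continuous_on_imp_measurable_dA)

lemma integrable_bergman: "f \<in> bergman \<Longrightarrow> integrable dA (\<lambda>z. (cmod (f z))\<^sup>2)"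
  by (simp add: bergman_def)

lemma borel_measurable_cnj [measurable]: "cnj \<in> borel_measurable borel"
  by (intro borel_measurable_continuous_onI continuous_intros)

lemma integrable_mult_cnj:
  fixes f g :: "'a \<Rightarrow> complex"
  assumes [measurable]: "f \<in> borel_measurable M" "g \<in> borel_measurable M"
    and "integrable M (\<lambda>z. (cmod (f z))\<^sup>2)" "integrable M (\<lambda>z. (cmod (g z))\<^sup>2)"
  shows "integrable M (\<lambda>z. f z * cnj (g z))"
proof (rule Bochner_Integration.integrable_bound)
  show "integrable M (\<lambda>z. (cmod (f z))\<^sup>2 + (cmod (g z))\<^sup>2)"
    using assms by simp
  show "AE z in M. norm (f z * cnj (g z)) \<le> norm ((cmod (f z))\<^sup>2 + (cmod (g z))\<^sup>2)"
  proof (rule AE_I2)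
    fix z
    have "0 \<le> (cmod (f z) - cmod (g z))\<^sup>2" by simp
    then show "norm (f z * cnj (g z)) \<le> norm ((cmod (f z))\<^sup>2 + (cmod (g z))\<^sup>2)"
      using mult_nonneg_nonneg[of "cmod (f z)" "cmod (g z)"]
      unfolding power2_diff norm_mult complex_mod_cnj real_norm_def by linarith
  qed
qed measurable

lemma integrable_mult_essentially_bounded:
  fixes f g :: "complex \<Rightarrow> complex"
  assumes phi: "essentially_bounded \<phi>" and f: "f \<in> bergman" and g: "g \<in> bergman"
  shows "integrable dA (\<lambda>z. \<phi> z * f z * cnj (g z))"
proof -
  obtain C where C: "AE z in dA. cmod (\<phi> z) \<le> C" and [measurable]: "\<phi> \<in> borel_measurable dA"
    using phi by (auto simp: essentially_bounded_def)
  note [measurable] = bergman_measurable[OF f] bergman_measurable[OF g]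
  show ?thesis
  proof (rule Bochner_Integration.integrable_bound)
    show "integrable dA (\<lambda>z. of_real C * (f z * cnj (g z)))"
      by (intro integrable_mult_right integrable_mult_cnj integrable_bergman f g) measurable
    show "AE z in dA. norm (\<phi> z * f z * cnj (g z)) \<le> norm (of_real C * (f z * cnj (g z)))"
      using C by eventually_elim (auto simp: norm_mult mult.assoc intro!: mult_right_mono)
  qed measurable
qed

lemma bergman_zero: "(\<lambda>_. 0) \<in> bergman"
  by (auto simp: bergman_def)

lemma bergman_add:
  assumes f: "f \<in> bergman" and g: "g \<in> bergman"
  shows "(\<lambda>z. f z + g z) \<in> bergman"
proof -
  note [measurable] = bergman_measurable[OF f] bergman_measurable[OF g]
  have "integrable dA (\<lambda>z. (cmod (f z + g z))\<^sup>2)"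
  proof (rule Bochner_Integration.integrable_bound)
    show "integrable dA (\<lambda>z. 2 * (cmod (f z))\<^sup>2 + 2 * (cmod (g z))\<^sup>2)"
      using integrable_bergman[OF f] integrable_bergman[OF g] by simp
    show "AE z in dA. norm ((cmod (f z + g z))\<^sup>2) \<le> norm (2 * (cmod (f z))\<^sup>2 + 2 * (cmod (g z))\<^sup>2)"
    proof (rule AE_I2)
      fix z
      have "(cmod (f z + g z))\<^sup>2 \<le> (cmod (f z) + cmod (g z))\<^sup>2"
        by (intro power_mono norm_triangle_ineq) auto
      also have "\<dots> \<le> 2 * (cmod (f z))\<^sup>2 + 2 * (cmod (g z))\<^sup>2"
        using zero_le_power2[of "cmod (f z) - cmod (g z)"] by (simp add: power2_sum power2_diff)
      finally show "norm ((cmod (f z + g z))\<^sup>2) \<le> norm (2 * (cmod (f z))\<^sup>2 + 2 * (cmod (g z))\<^sup>2)"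
        by simp
    qed
  qed measurable
  then show ?thesis using f g by (auto simp: bergman_def intro!: holomorphic_intros)
qed

lemma bergman_mult_const:
  assumes f: "f \<in> bergman"
  shows "(\<lambda>z. c * f z) \<in> bergman"
  using f by (auto simp: bergman_def norm_mult power_mult_distrib intro!: holomorphic_intros)

text \<open>The mean value property is applied to the square of \<open>f\<close>, which leads to the
  square norm without Cauchy--Schwarz; the factor 1/pi in \<open>dA\<close> cancels the pi in the
  area. This estimate later gives definiteness of the norm, completeness and the bound on
  \<Lambda>.\<close>

lemma bergman_point_evaluation:
  assumes f: "f \<in> bergman" and r: "0 < r" "r < 1 - cmod z"
  shows "r\<^sup>2 * (cmod (f z))\<^sup>2 \<le> (LINT w|dA. (cmod (f w))\<^sup>2)"
proof -
  let ?S = "ball 0 1 :: complex set"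
  have sub: "cball z r \<subseteq> ?S"
  proof
    fix w assume "w \<in> cball z r"
    then have "cmod (w - z) \<le> r" by (simp add: dist_norm norm_minus_commute)
    then show "w \<in> ?S" using norm_triangle_ineq[of "w - z" z] r by simp
  qed
  have hol: "(\<lambda>w. (f w)\<^sup>2) holomorphic_on ball z (1 - cmod z)"
  proof -
    have "ball z (1 - cmod z) \<subseteq> ?S"
    proof
      fix w assume "w \<in> ball z (1 - cmod z)"
      then show "w \<in> ?S"
        using norm_triangle_ineq[of "w - z" z] by (simp add: dist_norm norm_minus_commute)
    qed
    then show ?thesis
      using f by (auto simp: bergman_def intro!: holomorphic_intros intro: holomorphic_on_subset)
  qed
  have cont: "continuous_on ?S f"
    using f by (simp add: bergman_def holomorphic_on_imp_continuous_on)
  \<comment> \<open>The measure \<open>dA\<close> lives on the Lebesgue sigma-algebra of the disc,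
    whereas the mean value property is stated for \<open>lborel\<close>. The passage goes through
    \<open>lebesgue\<close> on the whole plane with an indicator, then through Borel measurability
    of the integrand (\<open>meas\<close>).\<close>
  have int: "integrable lebesgue (\<lambda>w. indicator ?S w *\<^sub>R (cmod (f w))\<^sup>2)"
    and eq: "(LINT w|dA. (cmod (f w))\<^sup>2) = (1 / pi) * (LINT w|lebesgue. indicator ?S w *\<^sub>R (cmod (f w))\<^sup>2)"
  proof -
    have m: "(\<lambda>w. (cmod (f w))\<^sup>2) \<in> borel_measurable (lebesgue_on ?S)"
      by (intro continuous_imp_measurable_on_sets_lebesgue continuous_intros cont) simp
    have "integrable (lebesgue_on ?S) (\<lambda>w. (1 / pi) *\<^sub>R (cmod (f w))\<^sup>2)"
      using integrable_bergman[OF f] m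
      by (simp add: dA_eq_density integrable_density)
    from integrable_scaleR_right[OF this, of pi]
    have "integrable (lebesgue_on ?S) (\<lambda>w. (cmod (f w))\<^sup>2)"
      by simp
    then show "integrable lebesgue (\<lambda>w. indicator ?S w *\<^sub>R (cmod (f w))\<^sup>2)"
      by (simp add: integrable_restrict_space)
    show "(LINT w|dA. (cmod (f w))\<^sup>2) = (1 / pi) * (LINT w|lebesgue. indicator ?S w *\<^sub>R (cmod (f w))\<^sup>2)"
      using m by (simp add: dA_eq_density integral_density integral_restrict_space)
  qed
  have meas: "(\<lambda>w. indicator ?S w *\<^sub>R (cmod (f w))\<^sup>2) \<in> borel_measurable lborel"
    using cont by (simp del: real_scaleR_def)
       (intro borel_measurable_continuous_on_indicator continuous_intros, auto)
  have contc: "continuous_on (cball z r) f"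
    using cont sub by (rule continuous_on_subset)
  have "pi * r\<^sup>2 * (cmod (f z))\<^sup>2 = cmod (of_real (pi * r\<^sup>2) * (f z)\<^sup>2)"
    by (simp add: norm_mult norm_power)
  also have "\<dots> = cmod (LINT w|lborel. indicator (cball z r) w *\<^sub>R (f w)\<^sup>2)"
    by (simp only: holomorphic_area_mean_value[OF hol r])
  also have "\<dots> \<le> (LINT w|lborel. norm (indicator (cball z r) w *\<^sub>R (f w)\<^sup>2))"
    by (rule integral_norm_bound)
  also have "\<dots> \<le> (LINT w|lborel. indicator ?S w *\<^sub>R (cmod (f w))\<^sup>2)"
  proof (rule integral_mono)
    show "integrable lborel (\<lambda>w. norm (indicator (cball z r) w *\<^sub>R (f w)\<^sup>2))"
      by (intro integrable_norm borel_integrable_compact compact_cball continuous_intros contc)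
    show "integrable lborel (\<lambda>w. indicator ?S w *\<^sub>R (cmod (f w))\<^sup>2)"
      using int meas by (simp only: integrable_completion)
    show "norm (indicator (cball z r) w *\<^sub>R (f w)\<^sup>2) \<le> indicator ?S w *\<^sub>R (cmod (f w))\<^sup>2" for w
      using sub by (auto simp: indicator_def norm_power)
  qed
  also have "\<dots> = pi * (LINT w|dA. (cmod (f w))\<^sup>2)"
    using meas by (simp only: eq integral_completion) simp
  finally show ?thesis by (simp add: mult.assoc)
qed

section \<open>Real Hilbert space structure on the Bergman space\<close>

typedef bergman_space = bergman
  using bergman_zero by blast

lemma Rep_bergman_space_measurable [measurable]: "Rep_bergman_space x \<in> borel_measurable dA"
  by (rule bergman_measurable[OF Rep_bergman_space])

lemma integrable_Rep_mult_cnj: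
  "integrable dA (\<lambda>z. Rep_bergman_space x z * cnj (Rep_bergman_space y z))"
  by (intro integrable_mult_cnj integrable_bergman Rep_bergman_space) measurable

lemma L2_inner_self: "L2_inner f f = of_real (LINT z|dA. (cmod (f z))\<^sup>2)"
  by (simp add: L2_inner_def complex_norm_square[symmetric] flip: integral_complex_of_real)

instantiation bergman_space :: real_inner
begin

definition "0 = Abs_bergman_space (\<lambda>_. 0)"
definition "x + y = Abs_bergman_space (\<lambda>z. Rep_bergman_space x z + Rep_bergman_space y z)"
definition "c *\<^sub>R x = Abs_bergman_space (\<lambda>z. of_real c * Rep_bergman_space x z)"
definition "- x = (-1) *\<^sub>R (x :: bergman_space)"
definition "x - y = x + - (y :: bergman_space)"
definition "x \<bullet> y = Re (L2_inner (Rep_bergman_space x) (Rep_bergman_space y))"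
definition "norm x = sqrt (x \<bullet> (x :: bergman_space))"
definition "sgn x = inverse (norm x) *\<^sub>R (x :: bergman_space)"
definition "dist x y = norm (x - y :: bergman_space)"
definition "(uniformity :: (bergman_space \<times> bergman_space) filter) = (INF e\<in>{0<..}. principal {(x, y). dist x y < e})"
definition "open (U :: bergman_space set) \<longleftrightarrow> (\<forall>x\<in>U. eventually (\<lambda>(x', y). x' = x \<longrightarrow> y \<in> U) uniformity)"

lemma Rep_zero: "Rep_bergman_space 0 z = 0"
  by (simp add: zero_bergman_space_def Abs_bergman_space_inverse bergman_zero)

lemma Rep_add: "Rep_bergman_space (x + y) z = Rep_bergman_space x z + Rep_bergman_space y z"
  by (simp add: plus_bergman_space_def Abs_bergman_space_inverse bergman_add Rep_bergman_space)

lemma Rep_scaleR: "Rep_bergman_space (c *\<^sub>R x) z = of_real c * Rep_bergman_space x z"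
  by (simp add: scaleR_bergman_space_def Abs_bergman_space_inverse bergman_mult_const Rep_bergman_space)

lemma Rep_diff: "Rep_bergman_space (x - y) z = Rep_bergman_space x z - Rep_bergman_space y z"
  by (simp add: minus_bergman_space_def uminus_bergman_space_def Rep_add Rep_scaleR)

lemma inner_self_eq: "x \<bullet> x = (LINT z|dA. (cmod (Rep_bergman_space x z))\<^sup>2)"
  by (simp add: inner_bergman_space_def L2_inner_self)

instance
proof
  fix x y w :: bergman_space and a b :: real
  note eqI = Rep_bergman_space_inject[THEN iffD1, OF ext]
  show "x + y + w = x + (y + w)" by (rule eqI) (simp add: Rep_add)
  show "x + y = y + x" by (rule eqI) (simp add: Rep_add)
  show "0 + x = x" by (rule eqI) (simp add: Rep_add Rep_zero)
  show "- x + x = 0" by (rule eqI) (simp add: Rep_add Rep_zero uminus_bergman_space_def Rep_scaleR)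
  show "x - y = x + - y" by (rule minus_bergman_space_def)
  show "a *\<^sub>R (x + y) = a *\<^sub>R x + a *\<^sub>R y" by (rule eqI) (simp add: Rep_add Rep_scaleR algebra_simps)
  show "(a + b) *\<^sub>R x = a *\<^sub>R x + b *\<^sub>R x" by (rule eqI) (simp add: Rep_add Rep_scaleR algebra_simps)
  show "a *\<^sub>R b *\<^sub>R x = (a * b) *\<^sub>R x" by (rule eqI) (simp add: Rep_scaleR)
  show "1 *\<^sub>R x = x" by (rule eqI) (simp add: Rep_scaleR)
  show "dist x y = norm (x - y)" by (rule dist_bergman_space_def)
  show "sgn x = inverse (norm x) *\<^sub>R x" by (rule sgn_bergman_space_def)
  show "(uniformity :: (bergman_space \<times> bergman_space) filter) = (INF e\<in>{0<..}. principal {(x, y). dist x y < e})"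
    by (rule uniformity_bergman_space_def)
  show "open U \<longleftrightarrow> (\<forall>x\<in>U. eventually (\<lambda>(x', y). x' = x \<longrightarrow> y \<in> U) uniformity)" for U :: "bergman_space set"
    by (rule open_bergman_space_def)
  show "norm x = sqrt (x \<bullet> x)" by (rule norm_bergman_space_def)
  show "x \<bullet> y = y \<bullet> x"
  proof -
    have "L2_inner (Rep_bergman_space y) (Rep_bergman_space x)
        = cnj (L2_inner (Rep_bergman_space x) (Rep_bergman_space y))"
      unfolding L2_inner_def by (subst Bochner_Integration.integral_cnj[symmetric]) (simp add: mult.commute)
    then show ?thesis by (simp add: inner_bergman_space_def)
  qed
  show "(x + y) \<bullet> w = x \<bullet> w + y \<bullet> w"
    by (simp add: inner_bergman_space_def L2_inner_def Rep_add ring_distribs integrable_Rep_mult_cnj)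
  show "(a *\<^sub>R x) \<bullet> y = a * (x \<bullet> y)"
    by (simp add: inner_bergman_space_def L2_inner_def Rep_scaleR mult.assoc)
  show "0 \<le> x \<bullet> x" by (simp add: inner_self_eq)
  show "x \<bullet> x = 0 \<longleftrightarrow> x = 0"
  proof
    assume "x \<bullet> x = 0"
    \<comment> \<open>Elements are functions, not classes modulo null sets, so vanishing is needed
      at every point: point evaluation handles the disc, the convention of being 0 elsewhere handles
      the rest.\<close>
    have "Rep_bergman_space x z = 0" for z
    proof (cases "cmod z < 1")
      case True
      then show ?thesis
        using bergman_point_evaluation[OF Rep_bergman_space, of "(1 - cmod z) / 2" z x] \<open>x \<bullet> x = 0\<close>
        by (simp add: inner_self_eq mult_le_0_iff)
    next
      case False
      then show ?thesis using Rep_bergman_space[of x] by (simp add: bergman_def)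
    qed
    then show "x = 0" by (intro eqI) (simp add: Rep_zero)
  qed (simp add: inner_self_eq Rep_zero)
qed

end

lemma power2_norm_bergman_space: "(norm x)\<^sup>2 = (LINT z|dA. (cmod (Rep_bergman_space x z))\<^sup>2)"
  by (simp add: power2_norm_eq_inner inner_self_eq)

lemma norm_bergman_space_eq: "norm x = L2_norm (Rep_bergman_space x)"
  by (simp add: norm_eq_sqrt_inner inner_self_eq L2_norm_def)

lemma Rep_bergman_space_bound:
  assumes "0 < r" "r < 1 - cmod z"
  shows "r * cmod (Rep_bergman_space x z) \<le> norm x"
proof (rule power2_le_imp_le)
  show "(r * cmod (Rep_bergman_space x z))\<^sup>2 \<le> (norm x)\<^sup>2"
    using bergman_point_evaluation[OF Rep_bergman_space assms, of x]
    by (simp add: power2_norm_bergman_space power_mult_distrib)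
qed simp

text \<open>By point evaluation a norm Cauchy sequence is locally uniformly Cauchy, so its pointwise
  limit is holomorphic. Fatou's lemma then gives square integrability of the limit and convergence
  in norm.\<close>

instance bergman_space :: complete_space
proof
  fix X :: "nat \<Rightarrow> bergman_space"
  assume X: "Cauchy X"
  define F where "F n = Rep_bergman_space (X n)" for n
  define G where "G z = (if z \<in> ball 0 1 then lim (\<lambda>n. F n z) else 0)" for z
  have F: "F n \<in> bergman" for n by (simp add: F_def Rep_bergman_space)
  have F_diff: "Rep_bergman_space (X n - X m) z = F n z - F m z" for n m z
    by (simp add: F_def Rep_diff)
  \<comment> \<open>With a third of the distance to the boundary as \<open>d\<close>, each point of
    \<open>cball z d\<close> keeps distance at least \<open>2 * d\<close> from the unit circle, so
    the evaluation bound holds there with the common radius \<open>d\<close>.\<close>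
  have unif: "uniform_limit (cball z d) F (\<lambda>z. lim (\<lambda>n. F n z)) sequentially"
    if d: "d = (1 - cmod z) / 3" "0 < d" for z d
  proof -
    have "uniformly_Cauchy_on (cball z d) F"
    proof (rule uniformly_Cauchy_onI)
      fix e :: real assume "e > 0"
      then obtain N where N: "\<And>m n. m \<ge> N \<Longrightarrow> n \<ge> N \<Longrightarrow> norm (X m - X n) < d * e"
        using CauchyD[OF X, of "d * e"] d by auto
      have "dist (F m w) (F n w) < e" if "w \<in> cball z d" "m \<ge> N" "n \<ge> N" for w m n
      proof -
        have "cmod w \<le> cmod z + d"
          using that norm_triangle_ineq[of z "w - z"] by (simp add: dist_norm norm_minus_commute)
        then have "d < 1 - cmod w" using d by (simp add: field_simps)
        then have "d * cmod (F m w - F n w) \<le> norm (X m - X n)"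
          using Rep_bergman_space_bound[OF d(2), of w "X m - X n"] by (simp add: F_diff)
        then have "d * cmod (F m w - F n w) < d * e"
          using N[OF that(2,3)] by (rule le_less_trans)
        then show ?thesis using d(2) by (simp add: dist_norm)
      qed
      then show "\<exists>M. \<forall>x\<in>cball z d. \<forall>m\<ge>M. \<forall>n\<ge>M. dist (F m x) (F n x) < e" by blast
    qed
    then show ?thesis
      using Cauchy_uniformly_convergent uniformly_convergent_uniform_limit_iff by blast
  qed
  have lim: "(\<lambda>n. F n z) \<longlonglongrightarrow> G z" if "z \<in> ball 0 1" for z
    using tendsto_uniform_limitI[OF unif[OF refl], of z z] that by (simp add: G_def)
  have "(\<lambda>z. lim (\<lambda>n. F n z)) holomorphic_on ball 0 1"
  proof (rule holomorphic_uniform_sequence[of _ F])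
    show "F n holomorphic_on ball 0 1" for n using F[of n] by (simp add: bergman_def)
    fix z :: complex assume z: "z \<in> ball 0 1"
    define d where "d = (1 - cmod z) / 3"
    have "cball z d \<subseteq> ball 0 1"
    proof
      fix w assume "w \<in> cball z d"
      then show "w \<in> ball 0 1"
        using norm_triangle_ineq[of z "w - z"] z by (simp add: dist_norm norm_minus_commute d_def)
    qed
    then show "\<exists>d>0. cball z d \<subseteq> ball 0 1 \<and> uniform_limit (cball z d) F (\<lambda>z. lim (\<lambda>n. F n z)) sequentially"
      using unif[OF d_def] z by (intro exI[of _ d]) (simp add: d_def)
  qed simp
  then have holG: "G holomorphic_on ball 0 1"
    by (rule holomorphic_transform) (simp add: G_def)
  have [measurable]: "F n \<in> borel_measurable dA" for n
    using F by (rule bergman_measurable)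
  have [measurable]: "G \<in> borel_measurable dA"
    using holG by (intro continuous_on_imp_measurable_dA holomorphic_on_imp_continuous_on)
  \<comment> \<open>For fixed \<open>n\<close> the integrand is the pointwise limit in
    \<open>m\<close> of the squared moduli of \<open>F n - F m\<close>, whose integrals are at most
    \<open>e\<^sup>2\<close> once \<open>m \<ge> N\<close>.\<close>
  have fatou: "(\<integral>\<^sup>+z. ennreal ((cmod (F n z - G z))\<^sup>2) \<partial>dA) \<le> ennreal (e\<^sup>2)"
    if N: "\<And>m. m \<ge> N \<Longrightarrow> norm (X n - X m) < e" for n N e
  proof -
    have "(\<integral>\<^sup>+z. ennreal ((cmod (F n z - G z))\<^sup>2) \<partial>dA)
        = (\<integral>\<^sup>+z. liminf (\<lambda>m. ennreal ((cmod (F n z - F m z))\<^sup>2)) \<partial>dA)"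
    proof (rule nn_integral_cong)
      fix z assume "z \<in> space dA"
      then have "(\<lambda>m. ennreal ((cmod (F n z - F m z))\<^sup>2)) \<longlonglongrightarrow> ennreal ((cmod (F n z - G z))\<^sup>2)"
        using lim[of z] by (intro tendsto_intros) auto
      then show "ennreal ((cmod (F n z - G z))\<^sup>2) = liminf (\<lambda>m. ennreal ((cmod (F n z - F m z))\<^sup>2))"
        by (intro lim_imp_Liminf[symmetric]) simp_all
    qed
    also have "\<dots> \<le> liminf (\<lambda>m. \<integral>\<^sup>+z. ennreal ((cmod (F n z - F m z))\<^sup>2) \<partial>dA)"
      by (rule nn_integral_liminf) measurable
    also have "\<dots> \<le> liminf (\<lambda>m. ennreal (e\<^sup>2))"
    proof (rule Liminf_mono, rule eventually_sequentiallyI)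
      fix m assume "m \<ge> N"
      have "(\<integral>\<^sup>+z. ennreal ((cmod (F n z - F m z))\<^sup>2) \<partial>dA) = ennreal ((norm (X n - X m))\<^sup>2)"
        using integrable_bergman[OF Rep_bergman_space[of "X n - X m"]]
        by (simp add: nn_integral_eq_integral power2_norm_bergman_space F_diff)
      also have "\<dots> \<le> ennreal (e\<^sup>2)"
        using N[OF \<open>m \<ge> N\<close>] by (intro ennreal_leI power_mono) auto
      finally show "(\<integral>\<^sup>+z. ennreal ((cmod (F n z - F m z))\<^sup>2) \<partial>dA) \<le> ennreal (e\<^sup>2)" .
    qed
    finally show ?thesis by (simp add: Liminf_const)
  qed
  have FG: "(\<lambda>z. F n z - G z) \<in> bergman \<and> (LINT z|dA. (cmod (F n z - G z))\<^sup>2) \<le> e\<^sup>2"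
    if N: "\<And>m. m \<ge> N \<Longrightarrow> norm (X n - X m) < e" for n N e
  proof -
    have bound: "(\<integral>\<^sup>+z. ennreal ((cmod (F n z - G z))\<^sup>2) \<partial>dA) \<le> ennreal (e\<^sup>2)"
      by (rule fatou[OF N])
    have "integrable dA (\<lambda>z. (cmod (F n z - G z))\<^sup>2)"
    proof (rule integrableI_bounded)
      show "(\<integral>\<^sup>+z. ennreal (norm ((cmod (F n z - G z))\<^sup>2)) \<partial>dA) < \<infinity>"
        using le_less_trans[OF bound] by simp
    qed measurable
    moreover from this have "(LINT z|dA. (cmod (F n z - G z))\<^sup>2) \<le> e\<^sup>2"
      using bound by (simp add: nn_integral_eq_integral)
    moreover have "G z = 0" if "z \<notin> ball 0 1" for z
      using that by (simp add: G_def)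
    ultimately show ?thesis
      using F[of n] holG by (auto simp: bergman_def intro!: holomorphic_intros)
  qed
  obtain N where "\<And>m. m \<ge> N \<Longrightarrow> norm (X N - X m) < 1"
    using CauchyD[OF X, of 1] by auto
  then have "(\<lambda>z. F N z - G z) \<in> bergman" using FG by blast
  \<comment> \<open>\<open>G\<close> is recovered as \<open>F N\<close> minus the difference
    \<open>F N - G\<close>, both already known to be in the space.\<close>
  then have "(\<lambda>z. F N z + (-1) * (F N z - G z)) \<in> bergman"
    by (intro bergman_add F bergman_mult_const)
  then have G: "G \<in> bergman" by simp
  have "X \<longlonglongrightarrow> Abs_bergman_space G"
  proof (rule LIMSEQ_I)
    fix e :: real assume e: "e > 0"
    then obtain N where N: "\<And>n m. n \<ge> N \<Longrightarrow> m \<ge> N \<Longrightarrow> norm (X n - X m) < e / 2"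
      using CauchyD[OF X, of "e / 2"] by auto
    have "norm (X n - Abs_bergman_space G) < e" if "n \<ge> N" for n
    proof -
      have "(norm (X n - Abs_bergman_space G))\<^sup>2 \<le> (e / 2)\<^sup>2"
        using FG[of N n "e / 2"] N that
        by (simp add: power2_norm_bergman_space Rep_diff F_def Abs_bergman_space_inverse G)
      then have "norm (X n - Abs_bergman_space G) \<le> e / 2"
        by (rule power2_le_imp_le) (use e in simp)
      then show ?thesis using e by simp
    qed
    then show "\<exists>N. \<forall>n\<ge>N. norm (X n - Abs_bergman_space G) < e" by blast
  qed
  then show "convergent X" by (auto simp: convergent_def)
qed

section \<open>Toeplitz operators\<close>

text \<open>Cauchy--Schwarz in the class \<open>real_inner\<close> controls only the real part of
  the integral, while bounding the form needs the integral of the modulus. Weighted AM-GM is used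
  with \<open>s\<close> chosen so that both terms integrate to half of
  \<open>norm x * norm y\<close>.\<close>

lemma integral_cmod_mult_le:
  "(LINT z|dA. cmod (Rep_bergman_space x z * cnj (Rep_bergman_space y z))) \<le> norm x * norm y"
proof (cases "x = 0 \<or> y = 0")
  case True
  then show ?thesis by (auto simp: Rep_zero)
next
  case False
  define s where "s = norm y / norm x"
  have s: "s > 0" using False by (simp add: s_def)
  let ?f = "Rep_bergman_space x" and ?g = "Rep_bergman_space y"
  have int: "integrable dA (\<lambda>z. (cmod (?f z))\<^sup>2)" "integrable dA (\<lambda>z. (cmod (?g z))\<^sup>2)"
    by (auto intro: integrable_bergman Rep_bergman_space)
  have "(LINT z|dA. cmod (?f z * cnj (?g z)))
      \<le> (LINT z|dA. s / 2 * (cmod (?f z))\<^sup>2 + 1 / (2 * s) * (cmod (?g z))\<^sup>2)"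
  proof (rule integral_mono)
    fix z
    have "0 \<le> (s * cmod (?f z) - cmod (?g z))\<^sup>2 / (2 * s)" using s by simp
    also have "\<dots> = s / 2 * (cmod (?f z))\<^sup>2 + 1 / (2 * s) * (cmod (?g z))\<^sup>2 - cmod (?f z * cnj (?g z))"
      using s by (simp add: power2_eq_square norm_mult field_simps)
    finally show "cmod (?f z * cnj (?g z)) \<le> s / 2 * (cmod (?f z))\<^sup>2 + 1 / (2 * s) * (cmod (?g z))\<^sup>2"
      by simp
  qed (use int integrable_Rep_mult_cnj in auto)
  also have "\<dots> = s / 2 * (norm x)\<^sup>2 + 1 / (2 * s) * (norm y)\<^sup>2"
    using int by (simp add: power2_norm_bergman_space)
  also have "\<dots> = norm x * norm y"
    using False by (simp add: s_def power2_eq_square field_simps)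
  finally show ?thesis .
qed

text \<open>The projection can be left out because testing is against elements of the Bergman space
  only: this is the real part of \<langle>P(\<phi> f), g\<rangle>, available before
  \<open>toeplitz\<close> is known to be well defined.\<close>

definition toeplitz_form :: "(complex \<Rightarrow> complex) \<Rightarrow> bergman_space \<Rightarrow> bergman_space \<Rightarrow> real" where
  "toeplitz_form \<phi> x y = Re (L2_inner (\<lambda>z. \<phi> z * Rep_bergman_space x z) (Rep_bergman_space y))"

lemma bounded_bilinear_toeplitz_form:
  assumes phi: "essentially_bounded \<phi>"
  shows "bounded_bilinear (toeplitz_form \<phi>)"
proof
  fix x x' y y' :: bergman_space and a b :: real
  note int = integrable_mult_essentially_bounded[OF phi Rep_bergman_space Rep_bergman_space]
  show "toeplitz_form \<phi> (x + x') y = toeplitz_form \<phi> x y + toeplitz_form \<phi> x' y"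
    by (simp add: toeplitz_form_def L2_inner_def Rep_add ring_distribs int)
  show "toeplitz_form \<phi> x (y + y') = toeplitz_form \<phi> x y + toeplitz_form \<phi> x y'"
    by (simp add: toeplitz_form_def L2_inner_def Rep_add ring_distribs int)
  have "L2_inner (\<lambda>z. \<phi> z * Rep_bergman_space (a *\<^sub>R x) z) (Rep_bergman_space y)
      = of_real a * L2_inner (\<lambda>z. \<phi> z * Rep_bergman_space x z) (Rep_bergman_space y)"
    by (simp add: L2_inner_def Rep_scaleR mult.left_commute mult.assoc flip: integral_mult_right_zero)
  then show "toeplitz_form \<phi> (a *\<^sub>R x) y = a *\<^sub>R toeplitz_form \<phi> x y"
    by (simp add: toeplitz_form_def)
  have "L2_inner (\<lambda>z. \<phi> z * Rep_bergman_space x z) (Rep_bergman_space (b *\<^sub>R y))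
      = of_real b * L2_inner (\<lambda>z. \<phi> z * Rep_bergman_space x z) (Rep_bergman_space y)"
    by (simp add: L2_inner_def Rep_scaleR mult.left_commute mult.assoc flip: integral_mult_right_zero)
  then show "toeplitz_form \<phi> x (b *\<^sub>R y) = b *\<^sub>R toeplitz_form \<phi> x y"
    by (simp add: toeplitz_form_def)
next
  note int = integrable_mult_essentially_bounded[OF phi Rep_bergman_space Rep_bergman_space]
  obtain C0 where C0: "AE z in dA. cmod (\<phi> z) \<le> C0"
    using phi by (auto simp: essentially_bounded_def)
  define C where "C = max 0 C0"
  have C: "C \<ge> 0" "AE z in dA. cmod (\<phi> z) \<le> C"
    using C0 by (auto simp: C_def elim: eventually_mono)
  have "norm (toeplitz_form \<phi> x y) \<le> norm x * norm y * C" for x y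
  proof -
    let ?f = "Rep_bergman_space x" and ?g = "Rep_bergman_space y"
    have "norm (toeplitz_form \<phi> x y) \<le> cmod (LINT z|dA. \<phi> z * ?f z * cnj (?g z))"
      by (simp add: toeplitz_form_def L2_inner_def abs_Re_le_cmod)
    also have "\<dots> \<le> (LINT z|dA. cmod (\<phi> z * ?f z * cnj (?g z)))"
      by (rule integral_norm_bound)
    also have "\<dots> \<le> (LINT z|dA. C * cmod (?f z * cnj (?g z)))"
    proof (rule integral_mono_AE)
      show "AE z in dA. cmod (\<phi> z * ?f z * cnj (?g z)) \<le> C * cmod (?f z * cnj (?g z))"
        using C(2) by eventually_elim (auto simp: norm_mult mult.assoc intro!: mult_right_mono)
    qed (use int integrable_Rep_mult_cnj in auto)
    also have "\<dots> \<le> C * (norm x * norm y)"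
      using integral_cmod_mult_le[of x y] C by (simp add: mult_left_mono)
    finally show ?thesis by (simp add: mult.commute)
  qed
  then show "\<exists>K. \<forall>x y. norm (toeplitz_form \<phi> x y) \<le> norm x * norm y * K" by blast
qed

text \<open>Resolves the definite description in \<open>toeplitz\<close>: the Riesz vector
  \<open>t\<close> satisfies the orthogonality condition, and any other candidate has the same real
  inner products as \<open>t\<close>, hence equals it.\<close>

lemma toeplitz_eqI:
  assumes phi: "essentially_bounded \<phi>" and form: "\<And>y. toeplitz_form \<phi> x y = t \<bullet> y"
  shows "toeplitz \<phi> (Rep_bergman_space x) = Rep_bergman_space t"
proof -
  let ?f = "Rep_bergman_space x"
  have diff: "L2_inner (\<lambda>z. \<phi> z * ?f z - Rep_bergman_space g z) h
      = L2_inner (\<lambda>z. \<phi> z * ?f z) h - L2_inner (Rep_bergman_space g) h"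
    if "h \<in> bergman" for g h
    using that integrable_mult_essentially_bounded[OF phi Rep_bergman_space that, of x]
      integrable_mult_cnj[OF _ _ integrable_bergman integrable_bergman, of "Rep_bergman_space g" h]
    by (simp add: L2_inner_def ring_distribs Rep_bergman_space bergman_measurable)
  have Re0: "Re (L2_inner (\<lambda>z. \<phi> z * ?f z - Rep_bergman_space t z) h) = 0" if "h \<in> bergman" for h
    using form[of "Abs_bergman_space h"] that
    by (simp add: diff toeplitz_form_def inner_bergman_space_def Abs_bergman_space_inverse)
  show ?thesis
    unfolding toeplitz_def
  proof (rule the_equality, intro conjI ballI)
    fix h assume h: "h \<in> bergman"
    let ?u = "\<lambda>z. \<phi> z * ?f z - Rep_bergman_space t z"
    \<comment> \<open>The form determines only the real part; testing against \<open>\<i> h\<close> recovers the imaginary part.\<close>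
    have "L2_inner ?u (\<lambda>z. \<i> * h z) = - \<i> * L2_inner ?u h"
      by (simp add: L2_inner_def mult.left_commute flip: integral_mult_right_zero)
    then have "Im (L2_inner ?u h) = 0"
      using Re0[OF bergman_mult_const[OF h, of \<i>]] by simp
    then show "L2_inner ?u h = 0" using Re0[OF h] by (simp add: complex_eq_iff)
  next
    fix g assume g: "g \<in> bergman \<and> (\<forall>h\<in>bergman. L2_inner (\<lambda>z. \<phi> z * ?f z - g z) h = 0)"
    define s where "s = Abs_bergman_space g"
    have s: "Rep_bergman_space s = g" using g by (simp add: s_def Abs_bergman_space_inverse)
    have "s \<bullet> y = t \<bullet> y" for y
      using g diff[OF Rep_bergman_space, of s y] form[of y] Rep_bergman_space[of y]
      by (auto simp: s toeplitz_form_def inner_bergman_space_def)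
    then have "s = t" using vector_eq_rdot by blast
    then show "g = Rep_bergman_space t" using s by simp
  qed (rule Rep_bergman_space)
qed

text \<open>The Lax--Milgram operator is \<open>toeplitz \<phi>\<close> conjugated by the bijection
  \<open>Rep_bergman_space\<close>; its lower bound gives the inverse the bound
  \<open>1 / c\<close>.\<close>

lemma invertible_toeplitz_if_coercive:
  assumes phi: "essentially_bounded \<phi>" and c: "c > 0"
    and coercive: "\<And>x. c * (norm x)\<^sup>2 \<le> toeplitz_form \<phi> x x"
  shows "invertible_on_bergman (toeplitz \<phi>)"
proof -
  obtain T where T: "\<And>x y. toeplitz_form \<phi> x y = T x \<bullet> y" "bij T" "\<And>x. c * norm x \<le> norm (T x)"
    using lax_milgram[OF bounded_bilinear_toeplitz_form[OF phi] c coercive] by blast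
  have eq: "toeplitz \<phi> (Rep_bergman_space x) = Rep_bergman_space (T x)" for x
    by (rule toeplitz_eqI[OF phi T(1)])
  have Rep: "bij_betw Rep_bergman_space UNIV bergman"
    by (auto simp: bij_betw_def inj_on_def Rep_bergman_space_inject
        type_definition.Rep_range[OF type_definition_bergman_space])
  have "bij_betw (toeplitz \<phi> \<circ> Rep_bergman_space) UNIV bergman"
    using bij_betw_trans[OF T(2) Rep] by (simp add: eq comp_def)
  then have "bij_betw (toeplitz \<phi>) bergman bergman"
    using bij_betw_comp_iff[OF Rep] by blast
  moreover have "L2_norm f \<le> (1 / c) * L2_norm (toeplitz \<phi> f)" if "f \<in> bergman" for f
  proof -
    obtain x where x: "f = Rep_bergman_space x" using Rep_bergman_space_cases[OF \<open>f \<in> bergman\<close>] .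
    have "norm x \<le> (1 / c) * norm (T x)" using T(3)[of x] c by (simp add: field_simps)
    then show ?thesis by (simp only: x eq norm_bergman_space_eq)
  qed
  ultimately show ?thesis unfolding invertible_on_bergman_def by blast
qed

section \<open>Coercivity of the form under the hypotheses on the symbol\<close>

text \<open>If the real part were smaller it would lie in [0,1] and dominate its own square as well
  as that of the imaginary part. Then \<open>\<rho>\<^sup>2 \<le> (cmod w)\<^sup>2 \<le> 2 * Re w <
  \<rho>\<^sup>2\<close>.\<close>

lemma Re_ge_of_square_Im_le_Re:
  fixes w :: complex
  assumes "0 < \<rho>" "\<rho> \<le> 1" "\<rho> \<le> cmod w" and Im: "\<bar>Im w\<bar>\<^sup>2 \<le> Re w"
  shows "\<rho>\<^sup>2 / 2 \<le> Re w"
proof (rule ccontr)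
  assume "\<not> \<rho>\<^sup>2 / 2 \<le> Re w"
  then have lt: "Re w < \<rho>\<^sup>2 / 2" by simp
  have Re0: "0 \<le> Re w" using Im by (smt (verit) zero_le_power2)
  have "\<rho>\<^sup>2 \<le> 1" using assms by (simp add: power_le_one)
  then have "(Re w)\<^sup>2 \<le> Re w"
    using lt Re0 by (simp add: power2_eq_square mult_left_le)
  moreover have "\<rho>\<^sup>2 \<le> (cmod w)\<^sup>2" using assms by (intro power_mono) auto
  ultimately show False using lt Im by (simp add: cmod_power2)
qed

theorem theorem4p1:
  fixes \<phi> :: "complex \<Rightarrow> complex" and \<rho> \<rho>0 :: real
  assumes phi: "essentially_bounded \<phi>"
    and rho0: "\<rho>0 = (if Linf_norm \<phi> = 0 then 1 / 32 else (1 / 32) * min 1 (1 / Linf_norm \<phi>))"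
    and rho: "0 < \<rho>" "\<rho> < \<rho>0"
    and i: "\<forall>z\<in>ball 0 1. cmod (\<phi> z) \<ge> \<rho> \<longrightarrow> Re (\<phi> z) \<ge> \<bar>Im (\<phi> z)\<bar>\<^sup>2"
    and ii: "\<forall>z\<in>ball 0 1. cmod z \<ge> \<rho> \<longrightarrow> cmod (\<phi> z) > \<rho>"
    and iii: "measure dA {z\<in>ball 0 1. cmod (\<phi> z) \<le> \<rho>} \<le> \<rho> ^ 6"
  shows "invertible_on_bergman (toeplitz \<phi>)"
proof (rule invertible_toeplitz_if_coercive[OF phi])
  \<comment> \<open>The branch for vanishing norm reads the reciprocal of 0 as infinity, so that the
    minimum is 1; in both branches 1/32 is an upper bound.\<close>
  have "\<rho>0 \<le> 1 / 32" using rho0 by (auto split: if_splits)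
  then have r32: "\<rho> < 1 / 32" using rho by simp
  show "\<rho>\<^sup>2 / 4 > 0" using rho by simp
  fix x
  let ?f = "Rep_bergman_space x"
  define L where "L = {z\<in>ball 0 1. cmod (\<phi> z) \<le> \<rho>}"
  have [measurable]: "\<phi> \<in> borel_measurable dA"
    using phi by (simp add: essentially_bounded_def)
  have L: "L \<in> sets dA"
    using borel_measurable_le[of "\<lambda>z. cmod (\<phi> z)" dA "\<lambda>_. \<rho>"] by (simp add: L_def)
  have int_f: "integrable dA (\<lambda>z. (cmod (?f z))\<^sup>2)"
    by (rule integrable_bergman[OF Rep_bergman_space])
  have int_L: "integrable dA (\<lambda>z. indicator L z * (8 * \<rho> * (norm x)\<^sup>2))"
    using L dA.emeasure_finite
    by (intro integrable_mult_left integrable_real_indicator) (auto simp: less_top[symmetric])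
  have int_phi: "integrable dA (\<lambda>z. \<phi> z * ?f z * cnj (?f z))"
    by (rule integrable_mult_essentially_bounded[OF phi Rep_bergman_space Rep_bergman_space])
  \<comment> \<open>The correction is charged on \<open>L\<close> only, where the real part of the
    symbol may be negative; \<open>8 * \<rho>\<close> is \<open>2 * \<rho>\<close> from the symbol
    times 4 from point evaluation.\<close>
  have pt: "\<rho>\<^sup>2 / 2 * (cmod (?f z))\<^sup>2 - indicator L z * (8 * \<rho> * (norm x)\<^sup>2) \<le> Re (\<phi> z * ?f z * cnj (?f z))"
    if z: "z \<in> ball 0 1" for z
  proof -
    have Re_eq: "Re (\<phi> z * ?f z * cnj (?f z)) = Re (\<phi> z) * (cmod (?f z))\<^sup>2"
      by (simp add: mult.assoc complex_norm_square[symmetric])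
    show ?thesis
    proof (cases "z \<in> L")
      case False
      then have "\<rho>\<^sup>2 / 2 \<le> Re (\<phi> z)"
        using rho r32 z i by (intro Re_ge_of_square_Im_le_Re) (auto simp: L_def)
      from mult_right_mono[OF this, of "(cmod (?f z))\<^sup>2"]
      show ?thesis using False unfolding Re_eq by simp
    next
      case True
      \<comment> \<open>By (ii) the point lies within 1/32 of the origin, so the disc of radius 1/2
        about it fits into the unit disc. This yields the factor 2, and 4 after squaring.\<close>
      then have "cmod z < \<rho>" using ii z by (force simp: L_def)
      then have "1 / 2 * cmod (?f z) \<le> norm x"
        using r32 by (intro Rep_bergman_space_bound) auto
      then have "(cmod (?f z))\<^sup>2 \<le> (2 * norm x)\<^sup>2" by (intro power_mono) auto
      then have f4: "(cmod (?f z))\<^sup>2 \<le> 4 * (norm x)\<^sup>2" by (simp add: power_mult_distrib)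
      have "\<rho>\<^sup>2 \<le> \<rho>" using rho r32 by (simp add: power2_eq_square mult_le_cancel_left1)
      moreover have "- \<rho> \<le> Re (\<phi> z)" using True abs_Re_le_cmod[of "\<phi> z"] by (auto simp: L_def)
      ultimately have "\<rho>\<^sup>2 / 2 - Re (\<phi> z) \<le> 2 * \<rho>" using rho by simp
      then have "(\<rho>\<^sup>2 / 2 - Re (\<phi> z)) * (cmod (?f z))\<^sup>2 \<le> 2 * \<rho> * (4 * (norm x)\<^sup>2)"
        using f4 rho by (intro mult_mono) auto
      then show ?thesis using True unfolding Re_eq by (simp add: algebra_simps)
    qed
  qed
  \<comment> \<open>By (iii) the correction costs at most \<open>8 * \<rho> ^ 7\<close>, that is
    \<open>\<rho>\<^sup>2\<close> times \<open>8 * \<rho> ^ 5\<close>. The latter is far below 1/4,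
    so half of the main term \<open>\<rho>\<^sup>2 / 2\<close> survives.\<close>
  have "\<rho> ^ 5 \<le> (1 / 32) ^ 5" using rho r32 by (intro power_mono) auto
  then have "\<rho>\<^sup>2 / 4 \<le> \<rho>\<^sup>2 * (1 / 2 - 8 * \<rho> ^ 5)"
    using rho by (simp add: power_one_over)
  also have "\<dots> = \<rho>\<^sup>2 / 2 - \<rho> ^ 6 * (8 * \<rho>)"
    by (simp add: algebra_simps power_numeral_reduce)
  also have "\<dots> \<le> \<rho>\<^sup>2 / 2 - measure dA L * (8 * \<rho>)"
    using iii rho by (simp add: L_def)
  finally have "\<rho>\<^sup>2 / 4 * (norm x)\<^sup>2 \<le> (\<rho>\<^sup>2 / 2 - measure dA L * (8 * \<rho>)) * (norm x)\<^sup>2"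
    by (rule mult_right_mono) simp
  also have "\<dots> = (LINT z|dA. \<rho>\<^sup>2 / 2 * (cmod (?f z))\<^sup>2 - indicator L z * (8 * \<rho> * (norm x)\<^sup>2))"
    using int_f int_L L sets.sets_into_space[OF L]
    by (simp add: power2_norm_bergman_space algebra_simps Int_absorb2)
  also have "\<dots> \<le> (LINT z|dA. Re (\<phi> z * ?f z * cnj (?f z)))"
    by (intro integral_mono Bochner_Integration.integrable_diff integrable_mult_right
        int_f int_L integrable_Re int_phi pt) simp
  also have "\<dots> = toeplitz_form \<phi> x x"
    unfolding toeplitz_form_def L2_inner_def by (rule integral_Re[OF int_phi])
  finally show "\<rho>\<^sup>2 / 4 * (norm x)\<^sup>2 \<le> toeplitz_form \<phi> x x" .
qed

end
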